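(* Consider the spatial economy with immobile labor described in the context, with parameters $\alpha<1$, $\alpha\neq 0$ and $\delta>0$. Then there exists a unique equilibrium price vector up to the normalization $q=1$: there is exactly one vector $p^*=(p_1^*,\dots,p_n^*,q^* )\in\mathbb{R}_{++}^{n+1}$ with $q^*=1$ such that $Z_i(p^* )=0$ for all $i=1,\dots,n+1$.
   Context: Notation: $\mathbb{R}_+=[0,\infty)$, $\mathbb{R}_{++}=(0,\infty)$, $|\cdot|$ is Lebesgue measure. Geography. $X\subset\mathbb{R}^2$ is open, bounded, connected, with Lipschitz boundary; $S=\{s_1,\dots,s_n\}\subset X$ is a finite set of cities; for each $s\in S$, $d_s:\mathbb{R}^2\to\mathbb{R}_+$ is continuous, and $d_i:=d_{s_i}$. For $s\ne t\in S$, $\gamma\in\mathbb{R}$, put $R_\gamma(s,t)=\{x\in\mathbb{R}^2: d_s(x)-d_t(x)<\gamma\}$. The system $(d_s)_{s\in S}$ is assumed admissible: for all $s\neq t\in S$ and each bounded open $C\subset\mathbb{R}^2$ there are constants $m_{st}<M_{st}$ such that $\gamma\mapsto|C\cap R_\gamma(s,t)|$ is continuously increasing from $0$ to $|C|$ as $\gamma$ grows from $m_{st}$ to $M_{st}$, with $C\cap R_\gamma(s,t)=\emptyset$ if $\gamma\le m_{st}$ and $C\subset R_\gamma(s,t)$ if $\gamma\ge M_{st}$. For $\lambda\in\mathbb{R}^n$ the additively weighted Voronoi regions are $\Omega_i(\lambda)=X\cap\bigcap_{j\ne i}R_{\lambda_i-\lambda_j}(s_i,s_j)$. Economy. $y^a:X\to\mathbb{R}_+$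 is continuous with $0<y^a_{\min}\le y^a(x)\le y^a_{\max}$; $y_i^m>0$ and $L_i^M>0$ for $i=1,\dots,n$; $L^A:X\to\mathbb{R}_+$ is continuous, bounded below by a positive constant, and integrable on $X$. Shipping costs are $\Delta(x,s_i)=\exp(\delta d_i(x))$. Prices: $p=(p_1,\dots,p_n,q)\in\mathbb{R}_{++}^{n+1}$. Demands for price pair $(q,p_i)$ and income $\omega$ are $$c^m(q,p_i,\omega)=\frac{p_i^{\frac{\alpha}{1-\alpha}}}{p_i^{\frac{\alpha}{1-\alpha}}+q^{\frac{\alpha}{1-\alpha}}}\frac{\omega}{q},\qquad c^a(q,p_i,\omega)=\frac{q^{\frac{\alpha}{1-\alpha}}}{p_i^{\frac{\alpha}{1-\alpha}}+q^{\frac{\alpha}{1-\alpha}}}\frac{\omega}{p_i}.$$ Incomes are $\omega_i=q\,y_i^m$ (urban workers in $s_i$) and $\omega(x,s_i)=p_iy^a(x)/\Delta(x,s_i)$ (farmer at $x$ trading at $s_i$). The Voronoi weights are $\lambda_i(p)=\frac1\delta\frac{1-\alpha}{\alpha}\log\bigl(1+(p_i/q)^{\frac{\alpha}{1-\alpha}}\bigr)$. Excess demands: for $i=1,\dots,n$, $$Z_i(p)=c^a(q,p_i,\omega_i)L_i^M+\int_{\Omega_i(\lambda(p))}\Bigl[c^a(q,p_i,\omega(x,s_i))-\frac{y^a(x)}{\Delta(x,s_i)}\Bigr]L^A(x)\,dx,$$ $$Z_{n+1}(p)=\sum_{i=1}^n\Bigl[(c^m(q,p_i,\omega_i)-y_i^m)L_i^M+\int_{\Omega_i(\lambda(p))}c^m(q,p_i,\omega(x,s_i))L^A(x)\,dx\Bigr].$$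 An equilibrium (with immobile labor) is a $p\in\mathbb{R}_{++}^{n+1}$ with $Z_i(p)=0$ for $i=1,\dots,n+1$.
   Formalization: For α<0 it is additionally assumed that no other city is closer to a city's location than that city itself: d_i(s_i) ≤ d_j(s_i) for all i, j (true if d_s(s)=0). Without it a city with a large fixed shipping cost can attract no farmers, and no equilibrium exists. *)

theory Defs
  imports "HOL-Analysis.Analysis"
begin

section \<open>Geography\<close>

text \<open>Near each boundary point, and in suitable orthonormal coordinates, the set is the strict
  epigraph of a Lipschitz function of one variable.\<close>

definition lipschitz_boundary :: "(real^2) set \<Rightarrow> bool" where
  "lipschitz_boundary X \<longleftrightarrow>
     (\<forall>x\<^sub>0 \<in> frontier X. \<exists>u v r L \<phi>.
        norm u = 1 \<and> norm v = 1 \<and> u \<bullet> v = 0 \<and> r > 0 \<and> L-lipschitz_on UNIV \<phi> \<and>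
        (\<forall>x \<in> ball x\<^sub>0 r. x \<in> X \<longleftrightarrow> \<phi> (u \<bullet> x) < v \<bullet> x))"

text \<open>The distance system is \<open>d\<close>, where \<open>d s x\<close> is the distance of \<open>x\<close> from the city \<open>s\<close>.\<close>

definition R_region ::
  "(real^2 \<Rightarrow> real^2 \<Rightarrow> real) \<Rightarrow> real \<Rightarrow> real^2 \<Rightarrow> real^2 \<Rightarrow> (real^2) set" where
  "R_region d \<gamma> s t = {x. d s x - d t x < \<gamma>}"

text \<open>``Increasing'' is meant in the weak sense. Strict increase on the whole of
  \<open>{m..M}\<close> fails already for Euclidean distances when \<open>C\<close> is the union of two small balls,
  around points at which \<open>d s - d t\<close> has different values.\<close>

definition admissible :: "(real^2) set \<Rightarrow> (real^2 \<Rightarrow> real^2 \<Rightarrow> real) \<Rightarrow> bool" where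
  "admissible S d \<longleftrightarrow>
     (\<forall>s\<in>S. \<forall>t\<in>S. s \<noteq> t \<longrightarrow> (\<forall>C. open C \<and> bounded C \<longrightarrow>
        (\<exists>m M. m < M \<and>
           continuous_on {m..M} (\<lambda>\<gamma>. measure lborel (C \<inter> R_region d \<gamma> s t)) \<and>
           mono_on {m..M} (\<lambda>\<gamma>. measure lborel (C \<inter> R_region d \<gamma> s t)) \<and>
           measure lborel (C \<inter> R_region d m s t) = 0 \<and>
           measure lborel (C \<inter> R_region d M s t) = measure lborel C \<and>
           (\<forall>\<gamma>\<le>m. C \<inter> R_region d \<gamma> s t = {}) \<and>
           (\<forall>\<gamma>\<ge>M. C \<subseteq> R_region d \<gamma> s t))))"

definition voronoi_region ::
  "(real^2) set \<Rightarrow> ('n \<Rightarrow> real^2) \<Rightarrow> (real^2 \<Rightarrow> real^2 \<Rightarrow> real) \<Rightarrow> real^'n \<Rightarrow> 'n::finite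
     \<Rightarrow> (real^2) set" where
  "voronoi_region X s d lam i =
     X \<inter> (\<Inter>j\<in>-{i}. R_region d (lam$i - lam$j) (s i) (s j))"


section \<open>Economy\<close>

definition shipping_cost ::
  "real \<Rightarrow> (real^2 \<Rightarrow> real^2 \<Rightarrow> real) \<Rightarrow> real^2 \<Rightarrow> real^2 \<Rightarrow> real" where
  "shipping_cost \<delta> d x t = exp (\<delta> * d t x)"

definition demand_m :: "real \<Rightarrow> real \<Rightarrow> real \<Rightarrow> real \<Rightarrow> real" where
  "demand_m \<alpha> q p \<omega> =
     p powr (\<alpha>/(1-\<alpha>)) / (p powr (\<alpha>/(1-\<alpha>)) + q powr (\<alpha>/(1-\<alpha>))) * (\<omega> / q)"

definition demand_a :: "real \<Rightarrow> real \<Rightarrow> real \<Rightarrow> real \<Rightarrow> real" where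
  "demand_a \<alpha> q p \<omega> =
     q powr (\<alpha>/(1-\<alpha>)) / (p powr (\<alpha>/(1-\<alpha>)) + q powr (\<alpha>/(1-\<alpha>))) * (\<omega> / p)"

definition voronoi_weights :: "real \<Rightarrow> real \<Rightarrow> real^'n \<Rightarrow> real \<Rightarrow> real^'n" where
  "voronoi_weights \<alpha> \<delta> p q =
     (\<chi> i. 1/\<delta> * ((1-\<alpha>)/\<alpha>) * ln (1 + (p$i / q) powr (\<alpha>/(1-\<alpha>))))"

text \<open>A price vector in \<open>n + 1\<close> coordinates is split into its first \<open>n\<close> coordinates \<open>p\<close>, indexed
  by the cities, and its last coordinate \<open>q\<close>. Correspondingly \<open>excess_demand_a i\<close> is the \<open>i\<close>-th
  excess demand and \<open>excess_demand_m\<close> is the last one. \<open>LM\<close> is urban labour, \<open>LA\<close> is the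
  density of farmers.\<close>

definition excess_demand_a ::
  "real \<Rightarrow> real \<Rightarrow> (real^2) set \<Rightarrow> ('n \<Rightarrow> real^2) \<Rightarrow> (real^2 \<Rightarrow> real^2 \<Rightarrow> real)
     \<Rightarrow> (real^2 \<Rightarrow> real) \<Rightarrow> ('n \<Rightarrow> real) \<Rightarrow> (real^2 \<Rightarrow> real) \<Rightarrow> ('n \<Rightarrow> real)
     \<Rightarrow> 'n::finite \<Rightarrow> real^'n \<Rightarrow> real \<Rightarrow> real" where
  "excess_demand_a \<alpha> \<delta> X s d ya ym LA LM i p q =
     demand_a \<alpha> q (p$i) (q * ym i) * LM i +
     (LINT x : voronoi_region X s d (voronoi_weights \<alpha> \<delta> p q) i | lborel.
        (demand_a \<alpha> q (p$i) (p$i * ya x / shipping_cost \<delta> d x (s i))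
           - ya x / shipping_cost \<delta> d x (s i)) * LA x)"

definition excess_demand_m ::
  "real \<Rightarrow> real \<Rightarrow> (real^2) set \<Rightarrow> ('n \<Rightarrow> real^2) \<Rightarrow> (real^2 \<Rightarrow> real^2 \<Rightarrow> real)
     \<Rightarrow> (real^2 \<Rightarrow> real) \<Rightarrow> ('n \<Rightarrow> real) \<Rightarrow> (real^2 \<Rightarrow> real) \<Rightarrow> ('n \<Rightarrow> real)
     \<Rightarrow> real^'n::finite \<Rightarrow> real \<Rightarrow> real" where
  "excess_demand_m \<alpha> \<delta> X s d ya ym LA LM p q =
     (\<Sum>i\<in>UNIV. (demand_m \<alpha> q (p$i) (q * ym i) - ym i) * LM i +
        (LINT x : voronoi_region X s d (voronoi_weights \<alpha> \<delta> p q) i | lborel.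
           demand_m \<alpha> q (p$i) (p$i * ya x / shipping_cost \<delta> d x (s i)) * LA x))"

definition equilibrium ::
  "real \<Rightarrow> real \<Rightarrow> (real^2) set \<Rightarrow> ('n \<Rightarrow> real^2) \<Rightarrow> (real^2 \<Rightarrow> real^2 \<Rightarrow> real)
     \<Rightarrow> (real^2 \<Rightarrow> real) \<Rightarrow> ('n \<Rightarrow> real) \<Rightarrow> (real^2 \<Rightarrow> real) \<Rightarrow> ('n \<Rightarrow> real)
     \<Rightarrow> real^'n::finite \<Rightarrow> real \<Rightarrow> bool" where
  "equilibrium \<alpha> \<delta> X s d ya ym LA LM p q \<longleftrightarrow>
     (\<forall>i. p$i > 0) \<and> q > 0 \<and>
     (\<forall>i. excess_demand_a \<alpha> \<delta> X s d ya ym LA LM i p q = 0) \<and>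
     excess_demand_m \<alpha> \<delta> X s d ya ym LA LM p q = 0"

text \<open>For \<open>\<alpha> < 0\<close>, \<open>\<alpha>/(1-\<alpha>)\<close> is negative, so every Voronoi weight is negative however high the
  price. If the distances \<open>d s x\<close> from one city carry a large fixed cost, that city attracts no
  farmer at any price at which the other cities can clear, its urban demand for the agricultural
  good is never met, and no equilibrium exists. Existence and uniqueness are therefore stated under
  the additional assumption, for \<open>\<alpha> < 0\<close> only, that no other city is closer to the location of
  a city than that city itself. This holds whenever \<open>d s s = 0\<close> for all cities \<open>s\<close>, that is, whenever
  shipping costs vanish within each city.\<close>

end

(* At q = 1, Walras' law reduces equilibrium to p_i^(1/(1-\<alpha>)) A_i(p) = y_i L_i for all i, where A_i(p)
   is the integral of y^a L^A exp(-\<delta> d_i) over the i-th market area.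

   Uniqueness: with u_i = exp(\<delta> \<lambda>_i(p)), the A_i are the partial derivatives of a convex function of
   u, hence monotone, whereas y_i L_i p_i^(-1/(1-\<alpha>)) strictly decreases in p_i and so in u_i.

   Existence: raising p_i enlarges A_i and shrinks the other A_j. Hence the set of price vectors with
   p_i^(1/(1-\<alpha>)) A_i(p) \<le> y_i L_i for all i is closed under componentwise maxima; it is nonempty and
   bounded, and its componentwise supremum is an equilibrium: were one of the inequalities strict
   there, that price could still be raised. *)

theory Submission
  imports Defs
begin

section \<open>Market areas\<close>

text \<open>For \<eta> > \<gamma> the tie set lies in the region at level \<eta> and outside the one
  at level \<gamma>. Its measure is thus at most the increment of \<open>?g\<close> from \<gamma> to
  \<eta>, which tends to 0 by right continuity.\<close>

lemma admissible_tie_null: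
  assumes "admissible S d" "s \<in> S" "t \<in> S" "s \<noteq> t" "open C" "bounded C"
    and "continuous_on UNIV (d s)" "continuous_on UNIV (d t)"
  shows "AE x in lborel. x \<in> C \<longrightarrow> d s x - d t x \<noteq> \<gamma>"
proof -
  let ?g = "\<lambda>\<gamma>. measure lborel (C \<inter> R_region d \<gamma> s t)"
  obtain m M where "m < M" and cont: "continuous_on {m..M} ?g"
    and lower: "\<And>\<gamma>. \<gamma> \<le> m \<Longrightarrow> C \<inter> R_region d \<gamma> s t = {}"
    and upper: "\<And>\<gamma>. \<gamma> \<ge> M \<Longrightarrow> C \<subseteq> R_region d \<gamma> s t"
    using assms(1)[unfolded admissible_def, rule_format, OF assms(2-4) conjI[OF assms(5,6)]]
    by (elim exE conjE) (rule that, auto)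
  let ?N = "{x \<in> C. d s x - d t x = \<gamma>}"
  have meas_C: "C \<in> sets lborel"
    using \<open>open C\<close> by simp
  have fin: "emeasure lborel C < \<infinity>"
    using \<open>bounded C\<close> by (rule emeasure_bounded_finite)
  have cont_diff: "continuous_on UNIV (\<lambda>x. d s x - d t x)"
    by (intro continuous_intros assms)
  have openR: "open (C \<inter> R_region d \<eta> s t)" for \<eta>
    unfolding R_region_def
    by (intro open_Int \<open>open C\<close> open_Collect_less cont_diff continuous_intros)
  have fm: "C \<inter> R_region d \<eta> s t \<in> fmeasurable lborel" for \<eta>
    using openR[of \<eta>] fin emeasure_mono[of "C \<inter> R_region d \<eta> s t" C lborel] meas_C
    by (intro fmeasurableI) (auto intro: le_less_trans)
  have closed: "closed {x. d s x - d t x = \<gamma>}"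
    by (intro closed_Collect_eq cont_diff continuous_intros)
  have N_eq: "?N = C \<inter> {x. d s x - d t x = \<gamma>}" by auto
  have meas_N: "?N \<in> sets lborel"
    unfolding N_eq using meas_C closed by (intro sets.Int) auto
  have fm_N: "?N \<in> fmeasurable lborel"
    using meas_N fin emeasure_mono[of ?N C lborel] meas_C
    by (intro fmeasurableI) (auto intro: le_less_trans)
  \<comment> \<open>On \<open>C\<close> the difference of distances is at least \<open>m\<close> and
    strictly below \<open>M\<close>, so the outer cases have no ties; \<gamma> < \<open>M\<close>
    leaves room for a limit from the right.\<close>
  consider "\<gamma> < m" | "m \<le> \<gamma>" "\<gamma> < M" | "M \<le> \<gamma>" by linarith
  then have "measure lborel ?N = 0"
  proof cases
    case 1
    then have "?N = {}" using lower[of m] unfolding R_region_def by auto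
    then show ?thesis by (simp only: measure_empty)
  next
    case 2
    have le: "measure lborel ?N \<le> ?g \<eta> - ?g \<gamma>" if "\<eta> > \<gamma>" for \<eta>
    proof -
      have "measure lborel ?N + ?g \<gamma> = measure lborel (?N \<union> (C \<inter> R_region d \<gamma> s t))"
        using fm_N fm[of \<gamma>]
        by (intro measure_Union[symmetric]) (auto simp: R_region_def fmeasurable_def)
      also have "\<dots> \<le> ?g \<eta>"
        by (rule measure_mono_fmeasurable[OF _ _ fm])
           (use that meas_N openR[of \<gamma>] in \<open>auto simp: R_region_def\<close>)
      finally show ?thesis by linarith
    qed
    have lim: "(?g \<longlongrightarrow> ?g \<gamma>) (at \<gamma> within {\<gamma><..M})"
    proof (rule tendsto_within_subset)
      show "(?g \<longlongrightarrow> ?g \<gamma>) (at \<gamma> within {m..M})"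
        using cont 2 unfolding continuous_on_def by auto
    qed (use 2 in auto)
    have "((\<lambda>\<eta>. ?g \<eta> - ?g \<gamma>) \<longlongrightarrow> ?g \<gamma> - ?g \<gamma>) (at \<gamma> within {\<gamma><..M})"
      by (intro tendsto_intros lim)
    moreover have "\<forall>\<^sub>F \<eta> in at \<gamma> within {\<gamma><..M}. measure lborel ?N \<le> ?g \<eta> - ?g \<gamma>"
      using le by (auto simp: eventually_at_filter)
    moreover have "at \<gamma> within {\<gamma><..M} \<noteq> bot"
      using 2 by (simp add: at_within_eq_bot_iff)
    ultimately have "measure lborel ?N \<le> ?g \<gamma> - ?g \<gamma>"
      using tendsto_lowerbound by blast
    then show ?thesis by (simp add: measure_le_0_iff)
  next
    case 3
    then have "?N = {}" using upper[of M] unfolding R_region_def by auto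
    then show ?thesis by (simp only: measure_empty)
  qed
  then have "?N \<in> null_sets lborel"
    using fm_N by (intro null_setsI) (auto simp: emeasure_eq_measure2)
  then show ?thesis
    by (rule AE_I') auto
qed

text \<open>\<open>f\<close> stands for farm output per unit of land before shipping losses. Of
  admissibility only \<open>ties\<close> is retained.\<close>

locale market_areas =
  fixes X :: "(real^2) set"
    and s :: "'n::finite \<Rightarrow> real^2"
    and d :: "real^2 \<Rightarrow> real^2 \<Rightarrow> real"
    and f :: "real^2 \<Rightarrow> real"
    and \<delta> :: real
  assumes openX: "open X"
    and sX: "s i \<in> X"
    and cont_d: "continuous_on UNIV (d (s i))"
    and d_nonneg: "0 \<le> d (s i) x"
    and ties: "i \<noteq> j \<Longrightarrow> AE x in lborel. x \<in> X \<longrightarrow> d (s i) x - d (s j) x \<noteq> \<gamma>"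
    and f_pos: "x \<in> X \<Longrightarrow> 0 < f x"
    and f_int: "set_integrable lborel X f"
    and delta_pos: "0 < \<delta>"
begin

abbreviation area :: "real^'n \<Rightarrow> 'n \<Rightarrow> (real^2) set" where
  "area lam i \<equiv> voronoi_region X s d lam i"

text \<open>The quantity that reaches city \<open>i\<close> after shipping losses.\<close>

definition mass :: "real^'n \<Rightarrow> 'n \<Rightarrow> real" where
  "mass lam i = (LINT x : area lam i | lborel. f x * exp (- \<delta> * d (s i) x))"

section \<open>Market areas partition \<open>X\<close> up to a null set\<close>

lemma mem_area:
  "x \<in> area lam i \<longleftrightarrow>
     x \<in> X \<and> (\<forall>j. j \<noteq> i \<longrightarrow> d (s i) x - d (s j) x < lam $ i - lam $ j)"
  by (auto simp: voronoi_region_def R_region_def)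

lemma open_area: "open (area lam i)"
  unfolding voronoi_region_def R_region_def
  by (intro open_Int openX open_INT ballI open_Collect_less continuous_intros cont_d) auto

lemma area_measurable [measurable]: "area lam i \<in> sets borel"
  using open_area by simp

lemma area_disjoint:
  assumes "x \<in> area lam i" "x \<in> area lam j" shows "i = j"
proof (rule ccontr)
  assume "i \<noteq> j"
  then have "d (s i) x - d (s j) x < lam $ i - lam $ j" "d (s j) x - d (s i) x < lam $ j - lam $ i"
    using assms by (auto simp: mem_area)
  then show False by linarith
qed

lemma AE_no_ties:
  "AE x in lborel. x \<in> X \<longrightarrow>
     (\<forall>i j. i \<noteq> j \<longrightarrow> d (s i) x - d (s j) x \<noteq> lam $ i - lam $ j)"
proof -
  have "AE x in lborel. \<forall>i\<in>UNIV. \<forall>j\<in>UNIV.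
      i \<noteq> j \<longrightarrow> x \<in> X \<longrightarrow> d (s i) x - d (s j) x \<noteq> lam $ i - lam $ j"
    by (intro AE_finite_allI finite) (use ties in auto)
  then show ?thesis by (rule AE_mp) auto
qed

text \<open>A location belongs to the city minimising \<open>d (s i) x - lam $ i\<close>; where
  there is no tie this minimum is strict.\<close>

lemma AE_area_cover: "AE x in lborel. x \<in> X \<longrightarrow> (\<exists>i. x \<in> area lam i)"
  using AE_no_ties[of lam]
proof (eventually_elim, intro impI)
  fix x assume nt: "x \<in> X \<longrightarrow>
      (\<forall>i j. i \<noteq> j \<longrightarrow> d (s i) x - d (s j) x \<noteq> lam $ i - lam $ j)" and x: "x \<in> X"
  obtain i where i: "\<And>j. d (s i) x - lam $ i \<le> d (s j) x - lam $ j"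
    using ex_min_if_finite[of "range (\<lambda>i. d (s i) x - lam $ i)"]
    by (auto simp: not_less)
  have "d (s i) x - d (s j) x < lam $ i - lam $ j" if "j \<noteq> i" for j
    using i[of j] nt x that by (smt (verit))
  then show "\<exists>i. x \<in> area lam i" using x unfolding mem_area by blast
qed

section \<open>Deliveries as functions of the weights\<close>

lemma weighted_integrable:
  assumes "A \<in> sets borel" "A \<subseteq> X" "continuous_on UNIV h" "\<And>x. 0 \<le> h x"
  shows "set_integrable lborel A (\<lambda>x. f x * exp (- \<delta> * h x))"
proof -
  have f_A: "set_integrable lborel A f"
    using set_integrable_subset[OF f_int] assms by auto
  have [measurable]: "h \<in> borel_measurable borel"
    using assms(3) by (rule borel_measurable_continuous_onI)
  have [measurable]: "(\<lambda>x. indicator A x * f x) \<in> borel_measurable borel"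
    using borel_measurable_integrable[OF f_A[unfolded set_integrable_def]] by simp
  have "integrable lborel (\<lambda>x. (indicator A x * f x) * exp (- \<delta> * h x))"
  proof (rule Bochner_Integration.integrable_bound)
    show "integrable lborel (\<lambda>x. indicator A x * f x)"
      using f_A unfolding set_integrable_def by simp
    show "AE x in lborel. norm (indicator A x * f x * exp (- \<delta> * h x)) \<le> norm (indicator A x * f x)"
      using assms(4) delta_pos
      by (intro AE_I2) (auto simp: abs_mult indicator_def intro!: mult_left_le)
  qed measurable
  then show ?thesis unfolding set_integrable_def by (simp add: mult.assoc)
qed

lemma area_subset: "area lam i \<subseteq> X"
  by (auto simp: mem_area)

lemma area_integrable: "set_integrable lborel (area lam i) (\<lambda>x. f x * exp (- \<delta> * d (s i) x))"
  by (intro weighted_integrable area_measurable area_subset cont_d d_nonneg)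

lemma mass_mono:
  assumes "\<And>j. j \<noteq> i \<Longrightarrow> lam $ i - lam $ j \<le> mu $ i - mu $ j"
  shows "mass lam i \<le> mass mu i"
  unfolding mass_def set_lebesgue_integral_def
proof (rule integral_mono)
  have sub: "area lam i \<subseteq> area mu i"
    using assms by (force simp: mem_area)
  show "indicator (area lam i) x *\<^sub>R (f x * exp (- \<delta> * d (s i) x))
      \<le> indicator (area mu i) x *\<^sub>R (f x * exp (- \<delta> * d (s i) x))" for x
    using sub f_pos[of x] area_subset[of mu i] by (auto simp: indicator_def)
qed (use area_integrable in \<open>auto simp: set_integrable_def\<close>)

lemma mass_nonneg: "0 \<le> mass lam i"
  unfolding mass_def set_lebesgue_integral_def
  using f_pos by (intro integral_nonneg_AE AE_I2) (auto simp: indicator_def mem_area less_imp_le)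

lemma mass_le_total: "mass lam i \<le> (LINT x : X | lborel. f x)"
  unfolding mass_def set_lebesgue_integral_def
proof (rule integral_mono)
  show "indicator (area lam i) x *\<^sub>R (f x * exp (- \<delta> * d (s i) x)) \<le> indicator X x *\<^sub>R f x" for x
    using f_pos[of x] delta_pos d_nonneg[of i x]
    by (auto simp: indicator_def mem_area intro!: mult_left_le)
qed (use area_integrable f_int in \<open>auto simp: set_integrable_def\<close>)

text \<open>Dominated convergence with majorant \<open>f\<close> on \<open>X\<close>: at a point
  without ties every defining inequality, or its strict reverse, persists for nearby weights, so the
  indicator is eventually constant.\<close>

lemma mass_tendsto:
  assumes "l \<longlonglongrightarrow> lam"
  shows "(\<lambda>k. mass (l k) i) \<longlonglongrightarrow> mass lam i"
  unfolding mass_def set_lebesgue_integral_def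
proof (rule integral_dominated_convergence)
  let ?w = "\<lambda>x. indicator X x *\<^sub>R f x"
  show "integrable lborel ?w" using f_int unfolding set_integrable_def .
  show "AE x in lborel. norm (indicator (area (l k) i) x *\<^sub>R (f x * exp (- \<delta> * d (s i) x))) \<le> ?w x" for k
    using f_pos delta_pos d_nonneg
    by (intro AE_I2) (auto simp: indicator_def mem_area abs_mult less_imp_le intro!: mult_left_le)
  show "(\<lambda>x. indicator (area lam i) x *\<^sub>R (f x * exp (- \<delta> * d (s i) x))) \<in> borel_measurable lborel"
    using area_integrable[of lam i] unfolding set_integrable_def by (rule borel_measurable_integrable)
  show "(\<lambda>x. indicator (area (l k) i) x *\<^sub>R (f x * exp (- \<delta> * d (s i) x))) \<in> borel_measurable lborel" for k
    using area_integrable[of "l k" i] unfolding set_integrable_def by (rule borel_measurable_integrable)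
  show "AE x in lborel.
      (\<lambda>k. indicator (area (l k) i) x *\<^sub>R (f x * exp (- \<delta> * d (s i) x)))
        \<longlonglongrightarrow> indicator (area lam i) x *\<^sub>R (f x * exp (- \<delta> * d (s i) x))"
    using AE_no_ties[of lam]
  proof eventually_elim
    fix x assume nt: "x \<in> X \<longrightarrow>
      (\<forall>i j. i \<noteq> j \<longrightarrow> d (s i) x - d (s j) x \<noteq> lam $ i - lam $ j)"
    have lim: "(\<lambda>k. l k $ i - l k $ j) \<longlonglongrightarrow> lam $ i - lam $ j" for j
      using assms by (intro tendsto_intros)
    have "\<forall>\<^sub>F k in sequentially. x \<in> area (l k) i \<longleftrightarrow> x \<in> area lam i"
    proof (cases "x \<in> X")
      case True
      have "\<forall>\<^sub>F k in sequentially. \<forall>j. j \<noteq> i \<longrightarrow>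
          (d (s i) x - d (s j) x < l k $ i - l k $ j \<longleftrightarrow> d (s i) x - d (s j) x < lam $ i - lam $ j)"
      proof (rule eventually_all_finite)
        fix j
        consider "d (s i) x - d (s j) x < lam $ i - lam $ j"
          | "d (s i) x - d (s j) x > lam $ i - lam $ j" | "j = i"
          using nt True by (metis linorder_neqE_linordered_idom)
        then show "\<forall>\<^sub>F k in sequentially. j \<noteq> i \<longrightarrow>
          (d (s i) x - d (s j) x < l k $ i - l k $ j \<longleftrightarrow> d (s i) x - d (s j) x < lam $ i - lam $ j)"
        proof cases
          case 1
          then show ?thesis using order_tendstoD(1)[OF lim[of j]] by (auto elim: eventually_mono)
        next
          case 2
          then show ?thesis using order_tendstoD(2)[OF lim[of j] 2] by (auto elim: eventually_mono)
        qed simp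
      qed
      then show ?thesis by eventually_elim (auto simp: mem_area)
    qed (simp add: mem_area)
    then show "(\<lambda>k. indicator (area (l k) i) x *\<^sub>R (f x * exp (- \<delta> * d (s i) x)))
        \<longlonglongrightarrow> indicator (area lam i) x *\<^sub>R (f x * exp (- \<delta> * d (s i) x))"
      by (intro tendsto_eventually) (auto elim!: eventually_mono simp: indicator_def)
  qed
qed

text \<open>With \<open>u i = exp (\<delta> * lam $ i)\<close>, the masses are the partial derivatives of the convex function
  mapping \<open>u\<close> to the integral over \<open>X\<close> of the maximum over \<open>i\<close> of \<open>u i * f x * exp (- \<delta> * d (s i) x)\<close>;
  this is the subgradient inequality.\<close>

lemma mass_subgradient:
  "(\<Sum>i\<in>UNIV. mass lam i * exp (\<delta> * mu $ i)) \<le> (\<Sum>i\<in>UNIV. mass mu i * exp (\<delta> * mu $ i))"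
proof -
  \<comment> \<open>The factor always carries \<open>mu\<close>, so the two sides differ only in the
    partition. At almost every point of \<open>X\<close> each sum has one nonzero term, and the
    partition of \<open>mu\<close> selects the largest candidate.\<close>
  let ?t = "\<lambda>lam x i. indicator (area lam i) x *\<^sub>R (f x * exp (- \<delta> * d (s i) x)) * exp (\<delta> * mu $ i)"
  have int: "integrable lborel (\<lambda>x. ?t lam x i)" for lam i
    using area_integrable[of lam i] unfolding set_integrable_def by (rule integrable_mult_left)
  have eq: "(\<Sum>i\<in>UNIV. mass lam i * exp (\<delta> * mu $ i)) = (\<integral>x. (\<Sum>i\<in>UNIV. ?t lam x i) \<partial>lborel)" for lam
  proof -
    have "(\<integral>x. (\<Sum>i\<in>UNIV. ?t lam x i) \<partial>lborel) = (\<Sum>i\<in>UNIV. \<integral>x. ?t lam x i \<partial>lborel)"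
      by (rule Bochner_Integration.integral_sum) (rule int)
    then show ?thesis
      unfolding mass_def set_lebesgue_integral_def by (simp only: integral_mult_left_zero)
  qed
  have "(\<integral>x. (\<Sum>i\<in>UNIV. ?t lam x i) \<partial>lborel) \<le> (\<integral>x. (\<Sum>i\<in>UNIV. ?t mu x i) \<partial>lborel)"
  proof (rule integral_mono_AE)
    show "AE x in lborel. (\<Sum>i\<in>UNIV. ?t lam x i) \<le> (\<Sum>i\<in>UNIV. ?t mu x i)"
      using AE_area_cover[of lam] AE_area_cover[of mu]
    proof eventually_elim
      fix x assume cover: "x \<in> X \<longrightarrow> (\<exists>i. x \<in> area lam i)" "x \<in> X \<longrightarrow> (\<exists>i. x \<in> area mu i)"
      have single: "(\<Sum>i\<in>UNIV. ?t lam x i) = f x * exp (- \<delta> * d (s k) x) * exp (\<delta> * mu $ k)"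
        if "x \<in> area lam k" for lam k
      proof -
        have "?t lam x i = (if i = k then f x * exp (- \<delta> * d (s k) x) * exp (\<delta> * mu $ k) else 0)" for i
          by (cases "i = k") (use that area_disjoint[OF that, of i] in \<open>auto simp: indicator_def\<close>)
        then show ?thesis by simp
      qed
      show "(\<Sum>i\<in>UNIV. ?t lam x i) \<le> (\<Sum>i\<in>UNIV. ?t mu x i)"
      proof (cases "x \<in> X")
        case True
        then obtain i j where i: "x \<in> area lam i" and j: "x \<in> area mu j" using cover by blast
        have "mu $ i - d (s i) x \<le> mu $ j - d (s j) x"
          using j by (cases "i = j") (force simp: mem_area)+
        then have "\<delta> * (mu $ i - d (s i) x) \<le> \<delta> * (mu $ j - d (s j) x)"
          using delta_pos by (intro mult_left_mono) auto
        then have "exp (- \<delta> * d (s i) x) * exp (\<delta> * mu $ i) \<le> exp (- \<delta> * d (s j) x) * exp (\<delta> * mu $ j)"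
          by (simp add: algebra_simps flip: exp_add)
        then show ?thesis
          unfolding single[OF i] single[OF j] mult.assoc
          using f_pos[OF True] by (intro mult_left_mono) auto
      next
        case False
        then show ?thesis by (simp add: mem_area indicator_def)
      qed
    qed
  qed (rule Bochner_Integration.integrable_sum, rule int)+
  then show ?thesis unfolding eq .
qed

text \<open>Almost every point of \<open>U\<close> is served by some city of \<open>I\<close>.
  Bounding its distance by the sum of all distances gives a lower bound that does not depend on
  \<open>lam\<close>.\<close>

lemma mass_sum_lower_bound:
  assumes "open U" "U \<subseteq> X" and "\<And>x j. x \<in> U \<Longrightarrow> j \<notin> I \<Longrightarrow> x \<notin> area lam j"
  shows "(LINT x : U | lborel. f x * exp (- \<delta> * (\<Sum>j\<in>UNIV. d (s j) x))) \<le> (\<Sum>i\<in>I. mass lam i)"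
proof -
  let ?t = "\<lambda>x i. indicator (area lam i) x *\<^sub>R (f x * exp (- \<delta> * d (s i) x))"
  have int: "integrable lborel (\<lambda>x. ?t x i)" for i
    using area_integrable[of lam i] unfolding set_integrable_def .
  have eq: "(\<Sum>i\<in>I. mass lam i) = (\<integral>x. (\<Sum>i\<in>I. ?t x i) \<partial>lborel)"
    unfolding mass_def set_lebesgue_integral_def by (simp only: int Bochner_Integration.integral_sum)
  have t_nonneg: "0 \<le> ?t x i" for x i
    using f_pos[of x] by (auto simp: indicator_def mem_area)
  show ?thesis
    unfolding eq set_lebesgue_integral_def
  proof (rule integral_mono_AE)
    have "set_integrable lborel U (\<lambda>x. f x * exp (- \<delta> * (\<Sum>j\<in>UNIV. d (s j) x)))"
      using assms by (intro weighted_integrable continuous_on_sum cont_d sum_nonneg d_nonneg) auto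
    then show "integrable lborel (\<lambda>x. indicator U x *\<^sub>R (f x * exp (- \<delta> * (\<Sum>j\<in>UNIV. d (s j) x))))"
      unfolding set_integrable_def .
    show "AE x in lborel. indicator U x *\<^sub>R (f x * exp (- \<delta> * (\<Sum>j\<in>UNIV. d (s j) x))) \<le> (\<Sum>i\<in>I. ?t x i)"
      using AE_area_cover[of lam]
    proof eventually_elim
      fix x assume cover: "x \<in> X \<longrightarrow> (\<exists>i. x \<in> area lam i)"
      show "indicator U x *\<^sub>R (f x * exp (- \<delta> * (\<Sum>j\<in>UNIV. d (s j) x))) \<le> (\<Sum>i\<in>I. ?t x i)"
      proof (cases "x \<in> U")
        case True
        then obtain i where i: "x \<in> area lam i" using cover assms by blast
        then have "i \<in> I" using assms(3) True by blast
        have "d (s i) x \<le> (\<Sum>j\<in>UNIV. d (s j) x)"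
          by (rule member_le_sum) (auto simp: d_nonneg)
        then have "f x * exp (- \<delta> * (\<Sum>j\<in>UNIV. d (s j) x)) \<le> f x * exp (- \<delta> * d (s i) x)"
          using f_pos[of x] True assms(2) delta_pos by (intro mult_left_mono) auto
        also have "\<dots> = ?t x i" using i by simp
        also have "\<dots> \<le> (\<Sum>i\<in>I. ?t x i)"
          by (rule member_le_sum[OF \<open>i \<in> I\<close>]) (use t_nonneg in auto)
        finally show ?thesis using True by simp
      next
        case False
        then have "indicator U x *\<^sub>R (f x * exp (- \<delta> * (\<Sum>j\<in>UNIV. d (s j) x))) = 0" by simp
        also have "0 \<le> (\<Sum>i\<in>I. ?t x i)" by (intro sum_nonneg t_nonneg)
        finally show ?thesis .
      qed
    qed
  qed (intro Bochner_Integration.integrable_sum int)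
qed

lemma weighted_integral_pos:
  assumes "open U" "U \<subseteq> X" "U \<noteq> {}" "continuous_on UNIV h" "\<And>x. 0 \<le> h x"
  shows "0 < (LINT x : U | lborel. f x * exp (- \<delta> * h x))"
proof -
  let ?F = "\<lambda>x. indicator U x *\<^sub>R (f x * exp (- \<delta> * h x))"
  have int: "integrable lborel ?F"
    using weighted_integrable[of U h] assms unfolding set_integrable_def by auto
  have nonneg: "0 \<le> ?F x" for x
    using f_pos[of x] assms(2) by (auto simp: indicator_def)
  have "\<not> (AE x in lborel. ?F x = 0)"
  proof
    assume "AE x in lborel. ?F x = 0"
    \<comment> \<open>Negligibility refers to the completed measure; there a nonempty open set
      cannot be null, although the integrand is nonzero on all of \<open>U\<close>.\<close>
    then have "AE x in lebesgue. ?F x = 0" by (rule AE_completion)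
    moreover have "?F x \<noteq> 0" if "x \<in> U" for x
      using f_pos[of x] assms(2) that by auto
    ultimately have "AE x in lebesgue. x \<notin> U"
      by (auto elim: AE_mp)
    then have "negligible U"
      using assms(1) by (auto simp: negligible_iff_null_sets AE_iff_null_sets)
    then show False using open_not_negligible assms by blast
  qed
  then have "integral\<^sup>L lborel ?F \<noteq> 0"
    using integral_nonneg_eq_0_iff_AE[OF int] nonneg by auto
  moreover have "0 \<le> integral\<^sup>L lborel ?F"
    using nonneg by (intro integral_nonneg_AE) auto
  ultimately show ?thesis
    unfolding set_lebesgue_integral_def by linarith
qed

end

section \<open>Market clearing\<close>

text \<open>\<open>w\<close> turns a price into a Voronoi weight. \<open>escape\<close> says that if
  all other prices are at most \<open>B\<close>, a high enough price at city \<open>i\<close> wins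
  the location of that city.\<close>

locale price_system = market_areas X s d f \<delta>
  for X and s :: "'n::finite \<Rightarrow> real^2" and d f \<delta> +
  fixes w :: "real \<Rightarrow> real" and \<kappa> :: real and a :: "'n \<Rightarrow> real"
  assumes w_less: "0 < t \<Longrightarrow> t < u \<Longrightarrow> w t < w u"
    and w_cont: "continuous_on {0<..} w"
    and kappa_pos: "0 < \<kappa>"
    and a_pos: "0 < a i"
    and escape: "0 < B \<Longrightarrow> \<exists>K>B. \<forall>j. d (s i) (s i) - d (s j) (s i) < w K - w B"
begin

definition deliveries :: "real^'n \<Rightarrow> 'n \<Rightarrow> real" where
  "deliveries p i = mass (\<chi> j. w (p $ j)) i"

text \<open>Left side of the reduced clearing condition. For \<kappa> = 1 / (1 - \<alpha>) it is
  price times quantity, multiplied by the factor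
  \<open>p $ i powr (\<alpha> / (1 - \<alpha>))\<close> from the demand shares.\<close>

definition revenue :: "real^'n \<Rightarrow> 'n \<Rightarrow> real" where
  "revenue p i = p $ i powr \<kappa> * deliveries p i"

lemma w_le: "0 < t \<Longrightarrow> t \<le> u \<Longrightarrow> w t \<le> w u"
  using w_less[of t u] by (cases "t = u") auto

lemma deliveries_mono:
  assumes "\<And>j. 0 < p $ j" "\<And>j. 0 < q $ j" "p $ i \<le> q $ i" "\<And>j. j \<noteq> i \<Longrightarrow> q $ j \<le> p $ j"
  shows "deliveries p i \<le> deliveries q i"
  unfolding deliveries_def
proof (rule mass_mono, simp)
  fix j assume "j \<noteq> i"
  then show "w (p $ i) - w (p $ j) \<le> w (q $ i) - w (q $ j)"
    using w_le[OF assms(1,3)] w_le[OF assms(2) assms(4)[OF \<open>j \<noteq> i\<close>]] by simp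
qed

lemma deliveries_nonneg: "0 \<le> deliveries p i"
  unfolding deliveries_def by (rule mass_nonneg)

lemma revenue_tendsto:
  assumes "l \<longlonglongrightarrow> p" "\<And>j. 0 < p $ j"
  shows "(\<lambda>k. revenue (l k) i) \<longlonglongrightarrow> revenue p i"
proof -
  have lim: "(\<lambda>k. l k $ j) \<longlonglongrightarrow> p $ j" for j
    using assms(1) by (rule tendsto_vec_nth)
  have "isCont w (p $ j)" for j
    using w_cont assms(2)[of j] by (simp add: continuous_on_eq_continuous_at)
  then have "(\<lambda>k. w (l k $ j)) \<longlonglongrightarrow> w (p $ j)" for j
    using lim by (rule isCont_tendsto_compose)
  then have "(\<lambda>k. \<chi> j. w (l k $ j)) \<longlonglongrightarrow> (\<chi> j. w (p $ j))"
    by (intro vec_tendstoI) simp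
  then have "(\<lambda>k. deliveries (l k) i) \<longlonglongrightarrow> deliveries p i"
    unfolding deliveries_def by (rule mass_tendsto)
  moreover have "(\<lambda>k. l k $ i powr \<kappa>) \<longlonglongrightarrow> p $ i powr \<kappa>"
    using assms(2)[of i] by (intro tendsto_powr lim tendsto_const) simp
  ultimately show ?thesis
    unfolding revenue_def by (intro tendsto_mult)
qed

section \<open>Uniqueness of clearing prices\<close>

lemma clearing_price_unique:
  assumes p: "\<And>i. 0 < p $ i" "\<And>i. revenue p i = a i"
    and q: "\<And>i. 0 < q $ i" "\<And>i. revenue q i = a i"
  shows "p = q"
proof (rule ccontr)
  assume "p \<noteq> q"
  then obtain k where k: "p $ k \<noteq> q $ k" by (auto simp: vec_eq_iff)
  let ?u = "\<lambda>p i. exp (\<delta> * w (p $ i))"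
  \<comment> \<open>Adding the subgradient inequality to its mirror image gives a nonnegative sum of
    the \<open>T i\<close>; market clearing makes each \<open>T i\<close> nonpositive, and negative
    where the prices differ.\<close>
  define T where "T i = (deliveries p i - deliveries q i) * (?u p i - ?u q i)" for i
  have sg: "(\<Sum>i\<in>UNIV. deliveries p i * ?u q i) \<le> (\<Sum>i\<in>UNIV. deliveries q i * ?u q i)" for p q
    using mass_subgradient[of "\<chi> j. w (p $ j)" "\<chi> j. w (q $ j)"] unfolding deliveries_def by simp
  have "0 \<le> (\<Sum>i\<in>UNIV. T i)"
    using sg[of p q] sg[of q p] unfolding T_def
    by (simp add: algebra_simps sum.distrib sum_subtractf)
  \<comment> \<open>Stated for arbitrary \<open>p\<close> and \<open>q\<close>, so that it serves
    both orders of the two prices.\<close>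
  have less: "(deliveries p i - deliveries q i) * (?u p i - ?u q i) < 0"
    if "0 < p $ i" "p $ i < q $ i" "revenue p i = a i" "revenue q i = a i" for p q i
  proof -
    have pw: "0 < p $ i powr \<kappa>" "p $ i powr \<kappa> < q $ i powr \<kappa>"
      using that kappa_pos by (auto intro: powr_less_mono2)
    have "deliveries p i = a i / p $ i powr \<kappa>" "deliveries q i = a i / q $ i powr \<kappa>"
      using that pw unfolding revenue_def by (auto simp: field_simps)
    then have "deliveries q i < deliveries p i"
      using divide_strict_left_mono[OF pw(2) a_pos[of i]] mult_pos_pos[of "q $ i powr \<kappa>" "p $ i powr \<kappa>"] pw
      by (simp only:)
    moreover have "?u p i < ?u q i"
      using w_less[OF that(1,2)] delta_pos by simp
    ultimately show ?thesis by (simp add: mult_pos_neg)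
  qed
  have neg: "T i < 0" if "p $ i \<noteq> q $ i" for i
  proof (cases "p $ i < q $ i")
    case True
    then show ?thesis unfolding T_def by (intro less p q)
  next
    case False
    then have "(deliveries q i - deliveries p i) * (?u q i - ?u p i) < 0"
      using that by (intro less p q) simp
    then show ?thesis unfolding T_def by (simp add: algebra_simps)
  qed
  have "T i \<le> 0" for i
    using neg[of i] by (cases "p $ i = q $ i") (auto simp: T_def)
  then have "(\<Sum>i\<in>UNIV. T i) < (\<Sum>i\<in>(UNIV::'n set). 0)"
    using neg[OF k] by (intro sum_strict_mono_ex1) auto
  then show False using \<open>0 \<le> (\<Sum>i\<in>UNIV. T i)\<close> by simp
qed

section \<open>Subclearing price vectors\<close>

definition subclearing :: "(real^'n) set" where
  "subclearing = {p. \<forall>i. 0 < p $ i \<and> revenue p i \<le> a i}"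

text \<open>A low common price works: deliveries are at most total output, and \<open>t\<close>
  solves \<open>t powr \<kappa> * T = Min (range a)\<close>.\<close>

lemma subclearing_nonempty: "subclearing \<noteq> {}"
proof -
  \<comment> \<open>The summand 1 makes \<open>T\<close> positive once the integral is known to be
    nonnegative.\<close>
  define T where "T = 1 + (LINT x : X | lborel. f x)"
  define t where "t = (Min (range a) / T) powr (1 / \<kappa>)"
  have "0 \<le> (LINT x : X | lborel. f x)"
    using mass_nonneg mass_le_total by (rule order_trans)
  then have T: "0 < T" unfolding T_def by linarith
  have min: "0 < Min (range a)" using a_pos by (subst Min_gr_iff) auto
  have t: "0 < t" "t powr \<kappa> = Min (range a) / T"
    using divide_pos_pos[OF min T] kappa_pos T min less_imp_neq[OF min] unfolding t_def
    by (simp_all add: powr_powr del: Min_gr_iff)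
  have "revenue (\<chi> j. t) i \<le> a i" for i
  proof -
    have "deliveries (\<chi> j. t) i \<le> T"
      unfolding deliveries_def T_def by (rule order_trans[OF mass_le_total]) simp
    then have "revenue (\<chi> j. t) i \<le> Min (range a) / T * T"
      unfolding revenue_def using divide_pos_pos[OF min T] t(2)
      by (simp add: mult_left_mono del: times_divide_eq_left)
    also have "\<dots> \<le> a i" using T by simp
    finally show ?thesis .
  qed
  then have "(\<chi> j. t) \<in> subclearing" unfolding subclearing_def using t by simp
  then show ?thesis by blast
qed

text \<open>Raising the other prices only shrinks a market area, so the componentwise maximum of two
  subclearing price vectors is subclearing.\<close>

lemma subclearing_max:
  assumes "p \<in> subclearing" "q \<in> subclearing"
  shows "(\<chi> i. max (p $ i) (q $ i)) \<in> subclearing" (is "?r \<in> _")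
proof -
  have pos: "0 < p $ i" "0 < q $ i" for i
    using assms unfolding subclearing_def by auto
  \<comment> \<open>\<open>p'\<close> is whichever vector attains the maximum in coordinate
    \<open>i\<close>.\<close>
  have *: "revenue ?r i \<le> a i"
    if "p' = p \<or> p' = q" "?r $ i = p' $ i" for p' i
  proof -
    have "deliveries ?r i \<le> deliveries p' i"
      using that pos by (intro deliveries_mono) (auto simp: less_max_iff_disj)
    then have "revenue ?r i \<le> revenue p' i"
      unfolding revenue_def that(2) by (intro mult_left_mono) auto
    also have "\<dots> \<le> a i" using that(1) assms unfolding subclearing_def by auto
    finally show ?thesis .
  qed
  have "revenue ?r i \<le> a i" for i
    using *[of p i] *[of q i] by (cases "q $ i \<le> p $ i") (auto simp: max_def)
  then show ?thesis
    unfolding subclearing_def using pos by (simp add: less_max_iff_disj)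
qed

text \<open>Turns separate witnesses for the coordinates into a common one by taking maxima; each
  \<open>P i\<close> is upward closed and so survives.\<close>

lemma subclearing_directed:
  assumes "finite J" "\<And>i. i \<in> J \<Longrightarrow> \<exists>p\<in>subclearing. P i (p $ i)"
    and up: "\<And>i t u. P i t \<Longrightarrow> t \<le> u \<Longrightarrow> P i u"
  shows "\<exists>p\<in>subclearing. \<forall>i\<in>J. P i (p $ i)"
  using assms(1,2)
proof (induction J rule: finite_induct)
  case empty
  then show ?case using subclearing_nonempty by auto
next
  case (insert j J)
  then obtain p q where pq: "p \<in> subclearing" "\<forall>i\<in>J. P i (p $ i)" "q \<in> subclearing" "P j (q $ j)"
    by (metis insertCI)
  then have "(\<chi> i. max (p $ i) (q $ i)) \<in> subclearing" by (intro subclearing_max)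
  moreover have "\<forall>i\<in>insert j J. P i ((\<chi> i. max (p $ i) (q $ i)) $ i)"
    using pq up by (metis insertE max.cobounded1 max.cobounded2 vec_lambda_beta)
  ultimately show ?case by blast
qed

text \<open>If the prices in the cities of \<open>I\<close> are unbounded and the other ones are not, then the cities
  in \<open>I\<close> eventually serve a fixed neighbourhood of one of them, while revenue bounds force their
  deliveries to vanish.\<close>

lemma subclearing_bounded: "bdd_above ((\<lambda>p. p $ i) ` subclearing)"
proof (rule ccontr)
  assume unbdd: "\<not> bdd_above ((\<lambda>p. p $ i) ` subclearing)"
  define I where "I = {i. \<not> bdd_above ((\<lambda>p. p $ i) ` subclearing)}"
  have "i \<in> I" using unbdd unfolding I_def by simp
  have "\<forall>j. \<exists>B. j \<notin> I \<longrightarrow> (\<forall>p\<in>subclearing. p $ j \<le> B)"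
    unfolding I_def bdd_above_def by auto
  then obtain b where b: "\<And>j p. j \<notin> I \<Longrightarrow> p \<in> subclearing \<Longrightarrow> p $ j \<le> b j"
    by metis
  \<comment> \<open>One bound for all prices outside \<open>I\<close>; the entry 1 ensures that it
    is positive.\<close>
  define B where "B = Max (insert 1 (range b))"
  have B: "0 < B" "b j \<le> B" for j
    unfolding B_def by (subst Max_gr_iff, simp, simp, simp) (rule Max_ge, auto)
  obtain K0 where K0: "K0 > B" "\<And>j. d (s i) (s i) - d (s j) (s i) < w K0 - w B"
    using escape[OF B(1), of i] by blast
  \<comment> \<open>A neighbourhood of \<open>s i\<close> on which city \<open>i\<close>, at a price
    of at least \<open>K0\<close>, beats every city whose price is at most \<open>B\<close>.\<close>
  define U where "U = X \<inter> (\<Inter>j. {x. d (s i) x - d (s j) x < w K0 - w B})"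
  have U: "open U" "U \<subseteq> X" "U \<noteq> {}"
  proof -
    show "open U" unfolding U_def
      by (intro open_Int openX open_INT ballI open_Collect_less continuous_on_diff cont_d
          continuous_on_const finite)
    have "s i \<in> U" using sX[of i] K0(2) unfolding U_def by auto
    then show "U \<noteq> {}" by blast
  qed (simp add: U_def)
  define c where "c = (LINT x : U | lborel. f x * exp (- \<delta> * (\<Sum>j\<in>UNIV. d (s j) x)))"
  have c: "0 < c"
    unfolding c_def
    by (intro weighted_integral_pos U continuous_on_sum cont_d sum_nonneg d_nonneg)
  define A where "A = (\<Sum>j\<in>UNIV. a j)"
  have A: "0 < A" unfolding A_def using a_pos by (intro sum_pos) auto
  \<comment> \<open>The second entry makes \<open>A / K powr \<kappa>\<close> at most
    \<open>c / 2\<close>, which will contradict the lower bound \<open>c\<close> on joint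
    deliveries.\<close>
  define K where "K = max K0 ((2 * A / c) powr (1 / \<kappa>))"
  have K: "K0 \<le> K" "0 < K" unfolding K_def using K0 B(1) by auto
  have "2 * A / c = ((2 * A / c) powr (1 / \<kappa>)) powr \<kappa>"
    using A c kappa_pos by (simp add: powr_powr)
  also have "\<dots> \<le> K powr \<kappa>"
    unfolding K_def using kappa_pos by (intro powr_mono2) auto
  finally have K_powr: "2 * A / c \<le> K powr \<kappa>" .
  have "\<exists>p\<in>subclearing. \<forall>i\<in>I. K \<le> p $ i"
  proof (rule subclearing_directed)
    show "\<exists>p\<in>subclearing. K \<le> p $ i" if "i \<in> I" for i
      using that unfolding I_def bdd_above_def by (auto simp: not_le intro: less_imp_le)
  qed auto
  then obtain p where p: "p \<in> subclearing" "\<And>i. i \<in> I \<Longrightarrow> K \<le> p $ i" by blast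
  have p_pos: "0 < p $ j" for j using p(1) unfolding subclearing_def by simp
  \<comment> \<open>Cities of \<open>I\<close> may take parts of \<open>U\<close> from one another,
    so only their joint deliveries are bounded below.\<close>
  have "c \<le> (\<Sum>j\<in>I. deliveries p j)"
    unfolding c_def deliveries_def
  proof (rule mass_sum_lower_bound[OF U(1,2)])
    fix x j assume x: "x \<in> U" and j: "j \<notin> I"
    have "w (p $ j) \<le> w B" using b[OF j p(1)] B(2)[of j] by (intro w_le p_pos) linarith
    moreover have "w K0 \<le> w (p $ i)" using p(2)[OF \<open>i \<in> I\<close>] K K0(1) B(1) by (intro w_le) linarith+
    moreover have "d (s i) x - d (s j) x < w K0 - w B" using x unfolding U_def by simp
    moreover have "i \<noteq> j" using j \<open>i \<in> I\<close> by blast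
    ultimately show "x \<notin> area (\<chi> j. w (p $ j)) j"
      unfolding mem_area by (auto intro!: exI[of _ i])
  qed
  also have "\<dots> \<le> (\<Sum>j\<in>I. a j / K powr \<kappa>)"
  proof (rule sum_mono)
    fix j assume "j \<in> I"
    have "deliveries p j * K powr \<kappa> \<le> deliveries p j * p $ j powr \<kappa>"
      using p(2)[OF \<open>j \<in> I\<close>] K kappa_pos by (intro mult_left_mono powr_mono2 deliveries_nonneg) auto
    also have "\<dots> \<le> a j"
      using p(1) unfolding subclearing_def revenue_def by (simp add: mult.commute)
    finally show "deliveries p j \<le> a j / K powr \<kappa>"
      using K by (simp add: field_simps)
  qed
  also have "\<dots> = (\<Sum>j\<in>I. a j) / K powr \<kappa>" by (simp add: sum_divide_distrib)
  also have "\<dots> \<le> A / K powr \<kappa>"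
    unfolding A_def using a_pos by (intro divide_right_mono sum_mono2) (auto simp: less_imp_le)
  also have "\<dots> \<le> c / 2"
    using K_powr K c by (simp add: field_simps)
  finally show False using c by simp
qed

section \<open>Existence of clearing prices\<close>

lemma clearing_price_exists: "\<exists>p. \<forall>i. 0 < p $ i \<and> revenue p i = a i"
proof -
  define P where "P = (\<chi> i. Sup ((\<lambda>p. p $ i) ` subclearing))"
  have upper: "p $ i \<le> P $ i" if "p \<in> subclearing" for p i
    unfolding P_def using cSup_upper[OF imageI[OF that] subclearing_bounded, of i] by simp
  obtain p where p: "p \<in> subclearing"
    using subclearing_nonempty by blast
  then have P_pos: "0 < P $ i" for i
    using less_le_trans[OF _ upper[OF p, of i]] by (simp add: subclearing_def)
  \<comment> \<open>Directedness lets a single subclearing vector approach all coordinate suprema at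
    once; hence \<open>P\<close> is a limit of such vectors and inherits their inequalities.\<close>
  have "\<exists>p\<in>subclearing. \<forall>i\<in>UNIV. P $ i - e < p $ i" if "0 < e" for e
  proof (rule subclearing_directed)
    fix i
    show "\<exists>p\<in>subclearing. P $ i - e < p $ i"
      using less_cSup_iff[OF _ subclearing_bounded, of i "P $ i - e"] subclearing_nonempty that
      unfolding P_def by simp
  qed auto
  then have "\<forall>k. \<exists>p\<in>subclearing. \<forall>i. P $ i - inverse (real (Suc k)) < p $ i"
    by simp
  then obtain l where l: "\<And>k. l k \<in> subclearing" "\<And>k i. P $ i - inverse (real (Suc k)) < l k $ i"
    by metis
  have "l \<longlonglongrightarrow> P"
  proof (rule vec_tendstoI)
    fix i
    have "(\<lambda>k. P $ i - inverse (real (Suc k))) \<longlonglongrightarrow> P $ i - 0"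
      by (intro tendsto_intros LIMSEQ_inverse_real_of_nat)
    then have lim: "(\<lambda>k. P $ i - inverse (real (Suc k))) \<longlonglongrightarrow> P $ i" by simp
    show "(\<lambda>k. l k $ i) \<longlonglongrightarrow> P $ i"
      by (rule tendsto_sandwich[OF _ _ lim tendsto_const])
         (use l upper in \<open>simp_all add: less_imp_le\<close>)
  qed
  then have le: "revenue P i \<le> a i" for i
    using l(1) P_pos unfolding subclearing_def
    by (intro LIMSEQ_le_const2[OF revenue_tendsto]) auto
  have "a i \<le> revenue P i" for i
  proof (rule ccontr)
    assume less: "\<not> a i \<le> revenue P i"
    \<comment> \<open>Only price \<open>i\<close> is raised, by an amount tending to 0. Continuity
      keeps revenue \<open>i\<close> below \<open>a i\<close> for some \<open>k\<close>, while the
      other revenues cannot rise; so \<open>q k\<close> is subclearing and exceeds the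
      supremum.\<close>
    define q where "q k = (\<chi> j. if j = i then P $ i + inverse (real (Suc k)) else P $ j)" for k
    have q_pos: "0 < q k $ j" for k j
      using P_pos[of j] unfolding q_def by (auto simp: add_pos_pos)
    have "(\<lambda>k. q k $ j) \<longlonglongrightarrow> P $ j" for j
    proof (cases "j = i")
      case True
      have "(\<lambda>k. P $ i + inverse (real (Suc k))) \<longlonglongrightarrow> P $ i + 0"
        by (intro tendsto_intros LIMSEQ_inverse_real_of_nat)
      then show ?thesis using True unfolding q_def by simp
    qed (simp add: q_def)
    then have "(\<lambda>k. revenue (q k) i) \<longlonglongrightarrow> revenue P i"
      by (intro revenue_tendsto P_pos vec_tendstoI)
    then have "\<forall>\<^sub>F k in sequentially. revenue (q k) i < a i"
      using less by (intro order_tendstoD) auto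
    then obtain k where k: "revenue (q k) i < a i"
      by (auto simp: eventually_sequentially)
    have "revenue (q k) j \<le> a j" for j
    proof (cases "j = i")
      case False
      then have "deliveries (q k) j \<le> deliveries P j"
        by (intro deliveries_mono q_pos P_pos) (auto simp: q_def)
      then have "revenue (q k) j \<le> revenue P j"
        using False unfolding revenue_def by (auto simp: q_def intro: mult_left_mono)
      then show ?thesis using le by (rule order_trans)
    qed (use k in simp)
    then have "q k \<in> subclearing" using q_pos unfolding subclearing_def by simp
    then have "q k $ i \<le> P $ i" by (rule upper)
    then show False unfolding q_def by simp
  qed
  then show ?thesis using P_pos le by (intro exI[of _ P]) (simp add: order_antisym)
qed

end

section \<open>Equilibrium\<close>

text \<open>A farmer's income is proportional to delivered output, so the price cancels and every
  farmer in the area sells the same share of it, which factors out of the integral.\<close>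

lemma excess_demand_a_unit_price:
  assumes "0 < p $ i"
  shows "excess_demand_a \<alpha> \<delta> X s d ya ym LA LM i p 1 =
    (ym i * LM i / p $ i - p $ i powr (\<alpha> / (1 - \<alpha>)) *
      (LINT x : voronoi_region X s d (voronoi_weights \<alpha> \<delta> p 1) i | lborel.
         ya x * LA x * exp (- \<delta> * d (s i) x))) / (1 + p $ i powr (\<alpha> / (1 - \<alpha>)))"
proof -
  define b where "b = p $ i powr (\<alpha> / (1 - \<alpha>))"
  have b: "0 < b" using assms unfolding b_def by simp
  have "(demand_a \<alpha> 1 (p $ i) (p $ i * ya x / shipping_cost \<delta> d x (s i))
      - ya x / shipping_cost \<delta> d x (s i)) * LA x
    = - (b / (1 + b)) * (ya x * LA x * exp (- \<delta> * d (s i) x))" for x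
  proof -
    have "1 / (b + 1) - 1 = - (b / (1 + b))" using b by (simp add: field_simps)
    moreover have "(demand_a \<alpha> 1 (p $ i) (p $ i * ya x / shipping_cost \<delta> d x (s i))
        - ya x / shipping_cost \<delta> d x (s i)) * LA x
      = (1 / (b + 1) - 1) * (ya x * LA x * exp (- \<delta> * d (s i) x))"
      using assms unfolding demand_a_def shipping_cost_def b_def[symmetric]
      by (simp add: exp_minus divide_inverse algebra_simps)
    ultimately show ?thesis by simp
  qed
  then have "excess_demand_a \<alpha> \<delta> X s d ya ym LA LM i p 1 = 1 / (b + 1) * (ym i / p $ i) * LM i +
     - (b / (1 + b)) * (LINT x : voronoi_region X s d (voronoi_weights \<alpha> \<delta> p 1) i | lborel.
         ya x * LA x * exp (- \<delta> * d (s i) x))"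
    unfolding excess_demand_a_def
    by (simp only: set_integral_mult_right) (simp add: demand_a_def b_def)
  then show ?thesis
    unfolding b_def[symmetric] using b by (simp add: diff_divide_distrib add.commute)
qed

text \<open>The identity holds city by city: the two demands exhaust the incomes of the workers and
  of the farmers trading there.\<close>

lemma walras_law_unit_price:
  assumes "\<And>i. 0 < p $ i"
  shows "excess_demand_m \<alpha> \<delta> X s d ya ym LA LM p 1 =
    - (\<Sum>i\<in>UNIV. p $ i * excess_demand_a \<alpha> \<delta> X s d ya ym LA LM i p 1)"
proof -
  have "(demand_m \<alpha> 1 (p $ i) (1 * ym i) - ym i) * LM i +
      (LINT x : voronoi_region X s d (voronoi_weights \<alpha> \<delta> p 1) i | lborel.
         demand_m \<alpha> 1 (p $ i) (p $ i * ya x / shipping_cost \<delta> d x (s i)) * LA x)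
    = - (p $ i * excess_demand_a \<alpha> \<delta> X s d ya ym LA LM i p 1)" for i
  proof -
    define b where "b = p $ i powr (\<alpha> / (1 - \<alpha>))"
    define M where "M = (LINT x : voronoi_region X s d (voronoi_weights \<alpha> \<delta> p 1) i | lborel.
         ya x * LA x * exp (- \<delta> * d (s i) x))"
    have b: "0 < b" using assms[of i] unfolding b_def by simp
    have "demand_m \<alpha> 1 (p $ i) (p $ i * ya x / shipping_cost \<delta> d x (s i)) * LA x
      = (b / (1 + b) * p $ i) * (ya x * LA x * exp (- \<delta> * d (s i) x))" for x
      unfolding demand_m_def shipping_cost_def b_def[symmetric]
      by (simp add: exp_minus divide_inverse algebra_simps)
    then have farmers: "(LINT x : voronoi_region X s d (voronoi_weights \<alpha> \<delta> p 1) i | lborel.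
         demand_m \<alpha> 1 (p $ i) (p $ i * ya x / shipping_cost \<delta> d x (s i)) * LA x)
      = (b / (1 + b) * p $ i) * M"
      unfolding M_def by simp
    have workers: "(demand_m \<alpha> 1 (p $ i) (1 * ym i) - ym i) * LM i = - (ym i * LM i / (1 + b))"
      using b unfolding demand_m_def b_def[symmetric] by (simp add: field_simps)
    have excess: "excess_demand_a \<alpha> \<delta> X s d ya ym LA LM i p 1 = (ym i * LM i / p $ i - b * M) / (1 + b)"
      unfolding b_def M_def by (rule excess_demand_a_unit_price[OF assms])
    have "b / (1 + b) * p $ i * M - ym i * LM i / (1 + b)
        = - (p $ i * ((ym i * LM i / p $ i - b * M) / (1 + b)))"
      using b assms[of i] by (simp add: divide_simps)
    then show ?thesis unfolding farmers workers excess by linarith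
  qed
  then show ?thesis
    unfolding excess_demand_m_def by (simp add: sum_negf)
qed

text \<open>Multiplying by the price merges the exponents, as 1 / (1 - \<alpha>) = \<alpha> / (1 -
  \<alpha>) + 1; Walras' law clears the remaining market.\<close>

lemma equilibrium_unit_price_iff:
  assumes "\<alpha> < 1"
  shows "equilibrium \<alpha> \<delta> X s d ya ym LA LM p 1 \<longleftrightarrow>
    (\<forall>i. 0 < p $ i \<and> p $ i powr (1 / (1 - \<alpha>)) *
      (LINT x : voronoi_region X s d (voronoi_weights \<alpha> \<delta> p 1) i | lborel.
         ya x * LA x * exp (- \<delta> * d (s i) x)) = ym i * LM i)"
proof -
  have "excess_demand_a \<alpha> \<delta> X s d ya ym LA LM i p 1 = 0 \<longleftrightarrow>
      p $ i powr (1 / (1 - \<alpha>)) *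
      (LINT x : voronoi_region X s d (voronoi_weights \<alpha> \<delta> p 1) i | lborel.
         ya x * LA x * exp (- \<delta> * d (s i) x)) = ym i * LM i" if "0 < p $ i" for i
  proof -
    define b where "b = p $ i powr (\<alpha> / (1 - \<alpha>))"
    have b: "0 < b" using that unfolding b_def by simp
    have "1 / (1 - \<alpha>) = \<alpha> / (1 - \<alpha>) + 1" using assms by (simp add: field_simps)
    then have "p $ i powr (1 / (1 - \<alpha>)) = b * p $ i"
      using that unfolding b_def by (simp add: powr_add)
    moreover have "(c / p $ i - b * M) / (1 + b) = 0 \<longleftrightarrow> b * p $ i * M = c" for c M
      using b that by (auto simp: field_simps add_pos_pos less_imp_neq[symmetric])
    ultimately show ?thesis
      unfolding excess_demand_a_unit_price[OF that] b_def[symmetric] by simp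
  qed
  moreover have "excess_demand_m \<alpha> \<delta> X s d ya ym LA LM p 1 = 0"
    if "\<And>i. 0 < p $ i" "\<And>i. excess_demand_a \<alpha> \<delta> X s d ya ym LA LM i p 1 = 0"
    using walras_law_unit_price[OF that(1)] that(2) by simp
  ultimately show ?thesis
    unfolding equilibrium_def by auto
qed

section \<open>The Voronoi weight as a function of one price\<close>

definition weight :: "real \<Rightarrow> real \<Rightarrow> real \<Rightarrow> real" where
  "weight \<alpha> \<delta> t = 1 / \<delta> * ((1 - \<alpha>) / \<alpha>) * ln (1 + t powr (\<alpha> / (1 - \<alpha>)))"

lemma voronoi_weights_unit_price: "voronoi_weights \<alpha> \<delta> p 1 = (\<chi> i. weight \<alpha> \<delta> (p $ i))"
  unfolding voronoi_weights_def weight_def by simp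

text \<open>For negative \<alpha> both the power and the factor (1 - \<alpha>) / \<alpha> reverse
  the order, so the composite is increasing for either sign.\<close>

lemma weight_strict_mono:
  assumes "\<alpha> < 1" "\<alpha> \<noteq> 0" "0 < \<delta>" "0 < t" "t < u"
  shows "weight \<alpha> \<delta> t < weight \<alpha> \<delta> u"
proof (cases "0 < \<alpha>")
  case True
  then have "t powr (\<alpha> / (1 - \<alpha>)) < u powr (\<alpha> / (1 - \<alpha>))"
    using assms by (intro powr_less_mono2) auto
  then have "ln (1 + t powr (\<alpha> / (1 - \<alpha>))) < ln (1 + u powr (\<alpha> / (1 - \<alpha>)))"
    using assms by (simp add: add_pos_pos)
  then show ?thesis
    unfolding weight_def using True assms by (intro mult_strict_left_mono) auto
next
  case False
  then have "u powr (\<alpha> / (1 - \<alpha>)) < t powr (\<alpha> / (1 - \<alpha>))"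
    using assms by (intro powr_less_mono2_neg) (auto simp: divide_neg_pos)
  then have "ln (1 + u powr (\<alpha> / (1 - \<alpha>))) < ln (1 + t powr (\<alpha> / (1 - \<alpha>)))"
    using assms by (simp add: add_pos_pos)
  moreover have "1 / \<delta> * ((1 - \<alpha>) / \<alpha>) < 0"
    using False assms by (simp add: mult_pos_neg divide_pos_neg)
  ultimately show ?thesis
    unfolding weight_def by (rule mult_strict_left_mono_neg)
qed

lemma continuous_on_weight: "continuous_on {0<..} (weight \<alpha> \<delta>)"
  unfolding weight_def
proof (intro continuous_intros ballI)
  show "1 + t powr (\<alpha> / (1 - \<alpha>)) \<noteq> 0" for t :: real
    using powr_ge_zero[of t "\<alpha> / (1 - \<alpha>)"] by linarith
qed auto

text \<open>Dropping the 1 inside the logarithm leaves exactly this bound. It shows that the weight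
  is unbounded above for positive \<alpha>, as \<open>escape\<close> requires.\<close>

lemma weight_ge_ln:
  assumes "0 < \<alpha>" "\<alpha> < 1" "0 < \<delta>" "0 < t"
  shows "ln t / \<delta> \<le> weight \<alpha> \<delta> t"
proof -
  have "\<alpha> / (1 - \<alpha>) * ln t = ln (t powr (\<alpha> / (1 - \<alpha>)))"
    using assms by (simp add: ln_powr)
  also have "\<dots> \<le> ln (1 + t powr (\<alpha> / (1 - \<alpha>)))"
    using assms by (subst ln_le_cancel_iff) (auto simp: add_pos_pos)
  finally have "1 / \<delta> * ((1 - \<alpha>) / \<alpha>) * (\<alpha> / (1 - \<alpha>) * ln t) \<le> weight \<alpha> \<delta> t"
    unfolding weight_def using assms by (intro mult_left_mono) auto
  then show ?thesis using assms by simp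
qed

section \<open>Existence and uniqueness of equilibrium\<close>

theorem theorem1:
  fixes \<alpha> \<delta> ya_min ya_max :: real
    and X :: "(real^2) set"
    and s :: "'n::finite \<Rightarrow> real^2"
    and d :: "real^2 \<Rightarrow> real^2 \<Rightarrow> real"
    and ya LA :: "real^2 \<Rightarrow> real"
    and ym LM :: "'n \<Rightarrow> real"
  assumes "\<alpha> < 1" and "\<alpha> \<noteq> 0" and "\<delta> > 0"
    and "open X" and "bounded X" and "connected X" and "lipschitz_boundary X"
    and "inj s" and "range s \<subseteq> X"
    and "\<And>t. t \<in> range s \<Longrightarrow> continuous_on UNIV (d t)"
    and "\<And>t x. t \<in> range s \<Longrightarrow> 0 \<le> d t x"
    and "admissible (range s) d"
    and own_city: "\<alpha> < 0 \<Longrightarrow> \<forall>i j. d (s i) (s i) \<le> d (s j) (s i)"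
    and "continuous_on X ya" and "0 < ya_min"
    and "\<And>x. x \<in> X \<Longrightarrow> ya_min \<le> ya x \<and> ya x \<le> ya_max"
    and "\<And>i. ym i > 0" and "\<And>i. LM i > 0"
    and "continuous_on X LA" and "\<exists>c>0. \<forall>x\<in>X. c \<le> LA x"
    and "set_integrable lborel X LA"
  shows "\<exists>!P :: (real^'n) \<times> real.
           snd P = 1 \<and> equilibrium \<alpha> \<delta> X s d ya ym LA LM (fst P) (snd P)"
proof -
  have ya: "0 < ya x" "ya x \<le> ya_max" if "x \<in> X" for x
    using assms(15) assms(16)[OF that] by linarith+
  have LA: "0 < LA x" if "x \<in> X" for x
    using assms(20) that by (metis less_le_trans)
  have int: "set_integrable lborel X (\<lambda>x. ya x * LA x)"
    unfolding set_integrable_def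
  proof (rule Bochner_Integration.integrable_bound)
    show "integrable lborel (\<lambda>x. ya_max * (indicator X x *\<^sub>R LA x))"
      using assms(21) unfolding set_integrable_def by (rule integrable_mult_right)
    have "(\<lambda>x. indicator X x *\<^sub>R (ya x * LA x)) \<in> borel_measurable borel"
      by (intro borel_measurable_continuous_on_indicator continuous_on_mult assms) (use assms(4) in simp)
    then show "(\<lambda>x. indicator X x *\<^sub>R (ya x * LA x)) \<in> borel_measurable lborel" by simp
    show "AE x in lborel. norm (indicator X x *\<^sub>R (ya x * LA x)) \<le> norm (ya_max * (indicator X x *\<^sub>R LA x))"
    proof (rule AE_I2)
      fix x
      show "norm (indicator X x *\<^sub>R (ya x * LA x)) \<le> norm (ya_max * (indicator X x *\<^sub>R LA x))"
        using ya[of x] LA[of x] by (cases "x \<in> X") (auto simp: abs_mult)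
    qed
  qed
  interpret price_system X s d "\<lambda>x. ya x * LA x" \<delta> "weight \<alpha> \<delta>" "1 / (1 - \<alpha>)" "\<lambda>i. ym i * LM i"
  proof unfold_locales
    show "AE x in lborel. x \<in> X \<longrightarrow> d (s i) x - d (s j) x \<noteq> \<gamma>" if "i \<noteq> j" for i j \<gamma>
      by (rule admissible_tie_null[OF assms(12)])
         (use assms(4,5,8,10) that in \<open>auto dest: injD\<close>)
    \<comment> \<open>For negative \<alpha> the weights are bounded, but \<open>own_city\<close>
      makes the left side nonpositive, so any price above \<open>B\<close> will do.\<close>
    show "\<exists>K>B. \<forall>j. d (s i) (s i) - d (s j) (s i) < weight \<alpha> \<delta> K - weight \<alpha> \<delta> B" if "0 < B" for B i
    proof (cases "\<alpha> < 0")
      case True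
      have "weight \<alpha> \<delta> B < weight \<alpha> \<delta> (B + 1)"
        using assms(1-3) that by (intro weight_strict_mono) auto
      then have "d (s i) (s i) - d (s j) (s i) < weight \<alpha> \<delta> (B + 1) - weight \<alpha> \<delta> B" for j
        using own_city[OF True, rule_format, of i j] by linarith
      then show ?thesis by (intro exI[of _ "B + 1"]) simp
    next
      case False
      then have pos: "0 < \<alpha>" using assms(2) by simp
      \<comment> \<open>The exponential lifts the weight of \<open>K\<close> by at least
        \<open>d (s i) (s i) + 1\<close> above that of \<open>B\<close>. Distances from other cities
        are nonnegative, and the 1 gives strictness.\<close>
      define K where "K = max (B + 1) (exp (\<delta> * (weight \<alpha> \<delta> B + d (s i) (s i) + 1)))"
      have "B < K" unfolding K_def by simp
      have "\<delta> * (weight \<alpha> \<delta> B + d (s i) (s i) + 1) \<le> ln K"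
        unfolding K_def by (subst ln_ge_iff) (auto simp: less_max_iff_disj)
      then have "weight \<alpha> \<delta> B + d (s i) (s i) + 1 \<le> ln K / \<delta>"
        using assms(3) by (simp add: field_simps)
      also have "\<dots> \<le> weight \<alpha> \<delta> K"
        using pos assms(1,3) \<open>B < K\<close> that by (intro weight_ge_ln) auto
      finally have "d (s i) (s i) - d (s j) (s i) < weight \<alpha> \<delta> K - weight \<alpha> \<delta> B" for j
        using assms(11)[of "s j" "s i"] by simp
      then show ?thesis using \<open>B < K\<close> by blast
    qed
  qed (use assms(1-4,9-11,17,18) ya LA int weight_strict_mono continuous_on_weight in auto)
  have iff: "equilibrium \<alpha> \<delta> X s d ya ym LA LM p 1 \<longleftrightarrow> (\<forall>i. 0 < p $ i \<and> revenue p i = ym i * LM i)" for p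
    unfolding equilibrium_unit_price_iff[OF assms(1)] revenue_def deliveries_def mass_def
      voronoi_weights_unit_price ..
  obtain p where p: "\<forall>i. 0 < p $ i \<and> revenue p i = ym i * LM i"
    using clearing_price_exists by blast
  show ?thesis
  proof (rule ex1I[of _ "(p, 1)"])
    show "snd (p, 1::real) = 1 \<and> equilibrium \<alpha> \<delta> X s d ya ym LA LM (fst (p, 1::real)) (snd (p, 1::real))"
      using p iff by simp
    fix P :: "(real^'n) \<times> real"
    assume P: "snd P = 1 \<and> equilibrium \<alpha> \<delta> X s d ya ym LA LM (fst P) (snd P)"
    then have "\<forall>i. 0 < fst P $ i \<and> revenue (fst P) i = ym i * LM i"
      unfolding iff[symmetric] by metis
    then have "fst P = p" using p by (intro clearing_price_unique) auto
    then show "P = (p, 1)" using P by (simp add: prod_eq_iff)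
  qed
qed

end
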